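(* Let $\epsilon>0$, $\delta\in(0,1]$, $T\ge 1$, and let $$\rho(\epsilon,\delta)=\left(\sqrt{\log(1/\delta)+\epsilon}-\sqrt{\log(1/\delta)}\right)^{2}.$$ Consider the multi-party resource sharing algorithm with $K$ parties and $m$ shared resources of capacities $c=(c_1,\dots,c_m)$ described in the context, run for $T$ iterations $t=0,\dots,T-1$. If the random vectors $\omega_k^{(t)}=(\omega_{k,1}^{(t)},\dots,\omega_{k,m}^{(t)})$ added to the allocations have independent components drawn as $$\omega_{k,j}^{(t)}\sim\mathcal N\left(0,\frac{T\,m\,c_j^{2}}{2\rho(\epsilon,\delta)}\right),\qquad k=1,\dots,K,\ j=1,\dots,m,\ t=0,\dots,T-1,$$ (independently over all $k,j,t$), then the algorithm provides $(\epsilon,\delta)$-local differential privacy.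
   Context: Setting. There are $K>1$ parties and $m\ge 1$ shared resources with publicly known capacity vector $c\in[0,\infty)^m$. Party $k$ has a private dataset $\mathcal D_k=\{A_k,B_k,b_k,u_k\}$ with $A_k\in\mathbb R^{m\times n_k}$, $B_k\in\mathbb R^{m_k\times n_k}$, $b_k\in\mathbb R^{m_k}$, $u_k\in\mathbb R^{n_k}$. For $\lambda\in\mathbb R^m$, the sub-problem of party $k$ is the linear program $$g(\lambda;\mathcal D_k)=\max_{x_k\in\mathbb R^{n_k},\,s_k\in\mathbb R^m}\{u_k^\top x_k-s_k^\top\lambda:\ A_kx_k\le s_k,\ B_kx_k\le b_k,\ 0\le s_k\le c\}$$ (the constraint $s_k\le c$ is assumed to be included for every party). Datasets are assumed to be such that this problem has an optimal solution for every $\lambda$; $\mathscr D$ denotes the set of all possible datasets of a single party. When the maximizer is not unique, $\arg\max$ denotes a fixed (measurable) selection. Algorithm. Start with $\lambda^{(-1)}=\lambda^{(0)}=0$. With given step-sizes $\nu^{(t)}>0$ and a momentum parameter $\gamma\ge 0$ ($\gamma=0$ meaning no momentum), at each iteration $t$ perform $$(x_k^{(t)},s_k^{(t)})=\arg\max\, g(\lambda^{(t)};\mathcal D_k),\quad k=1,\dots,K,$$ $$\tilde s_k^{(t)}=s_k^{(t)}+\omega_k^{(t)},\quad k=1,\dots,K,$$ $$\lambda^{(t+1)}=\lambda^{(t)}-\nu^{(t)}\Big(c-\sum_{k=1}^K\tilde s_k^{(t)}\Big)+\gamma\big(\lambda^{(t)}-\lambda^{(t-1)}\big).$$ The outputs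 published by party $k$ are the noisy allocations $\tilde s_k^{(t)}$. Local differential privacy. A randomized algorithm with random source $\omega\sim\mu$, taking a dataset $\mathcal D\in\mathscr D$ of a single party and returning $A(\omega,\mathcal D)\in\mathcal O$, is $(\epsilon,\delta)$-locally differentially private if for all $\mathcal D,\mathcal D'\in\mathscr D$ and all (measurable) $S\subseteq\mathcal O$, $$\mathbb P[A(\omega,\mathcal D)\in S]\le e^{\epsilon}\,\mathbb P[A(\omega,\mathcal D')\in S]+\delta .$$ The multi-party algorithm provides $(\epsilon,\delta)$-local differential privacy if, for each party $k$ and any fixed datasets of the other parties, the randomized map from $\mathcal D_k$ to all the outputs published over the $T$ iterations is $(\epsilon,\delta)$-locally differentially private. $\mathcal N(0,0)$ denotes the point mass at $0$. *)

theory Defs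
  imports "HOL-Probability.Probability" "Jordan_Normal_Form.Matrix"
begin

record dataset =
  dsA :: "real mat"
  dsB :: "real mat"
  dsb :: "real Matrix.vec"
  dsu :: "real Matrix.vec"

text \<open>The numbers of private variables and private constraints are not fixed: they are
  \<open>dim_vec (dsu D)\<close> and \<open>dim_vec (dsb D)\<close>, and may differ from dataset to dataset.
  The number of resources is \<open>dim_vec c\<close>, for the capacity vector \<open>c\<close>.\<close>

definition wf_dataset :: "nat \<Rightarrow> dataset \<Rightarrow> bool" where
  "wf_dataset m D \<longleftrightarrow>
     dsA D \<in> carrier_mat m (dim_vec (dsu D)) \<and>
     dsB D \<in> carrier_mat (dim_vec (dsb D)) (dim_vec (dsu D))"

definition feasible :: "real Matrix.vec \<Rightarrow> dataset \<Rightarrow> real Matrix.vec \<times> real Matrix.vec \<Rightarrow> bool" where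
  "feasible c D = (\<lambda>(x, s).
     x \<in> carrier_vec (dim_vec (dsu D)) \<and> s \<in> carrier_vec (dim_vec c) \<and>
     dsA D *\<^sub>v x \<le> s \<and> dsB D *\<^sub>v x \<le> dsb D \<and> 0\<^sub>v (dim_vec c) \<le> s \<and> s \<le> c)"

definition objective :: "dataset \<Rightarrow> real Matrix.vec \<Rightarrow> real Matrix.vec \<times> real Matrix.vec \<Rightarrow> real" where
  "objective D l = (\<lambda>(x, s). scalar_prod (dsu D) x - scalar_prod s l)"

definition optimal :: "real Matrix.vec \<Rightarrow> dataset \<Rightarrow> real Matrix.vec \<Rightarrow> real Matrix.vec \<times> real Matrix.vec \<Rightarrow> bool" where
  "optimal c D l p \<longleftrightarrow> is_arg_max (objective D l) (feasible c D) p"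

definition datasets :: "real Matrix.vec \<Rightarrow> dataset set" where
  "datasets c = {D. wf_dataset (dim_vec c) D \<and>
                    (\<forall>l \<in> carrier_vec (dim_vec c). \<exists>p. optimal c D l p)}"

text \<open>The Borel \<open>\<sigma>\<close>-algebra of $n$-dimensional real space, carried over to the matrix library's vectors.\<close>

definition vec_borel :: "nat \<Rightarrow> real Matrix.vec measure" where
  "vec_borel n = vimage_algebra (carrier_vec n) (\<lambda>v. \<lambda>i\<in>{..<n}. vec_index v i)
                   (\<Pi>\<^sub>M i\<in>{..<n}. borel)"

definition argmax_selection ::
    "real Matrix.vec \<Rightarrow> (dataset \<Rightarrow> real Matrix.vec \<Rightarrow> real Matrix.vec \<times> real Matrix.vec) \<Rightarrow> bool" where
  "argmax_selection c sel \<longleftrightarrow>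
     (\<forall>D \<in> datasets c.
        (\<forall>l \<in> carrier_vec (dim_vec c). optimal c D l (sel D l)) \<and>
        sel D \<in> vec_borel (dim_vec c) \<rightarrow>\<^sub>M vec_borel (dim_vec (dsu D)) \<Otimes>\<^sub>M vec_borel (dim_vec c))"

definition noisy_allocation ::
    "(dataset \<Rightarrow> real Matrix.vec \<Rightarrow> real Matrix.vec \<times> real Matrix.vec)
      \<Rightarrow> dataset \<Rightarrow> real Matrix.vec \<Rightarrow> real Matrix.vec \<Rightarrow> real Matrix.vec" where
  "noisy_allocation sel D l w = snd (sel D l) + w"

text \<open>\<open>multiplier c K \<nu> \<gamma> sel Ds w t\<close> is $\lambda^{(t)}$ when party \<open>k\<close> holds \<open>Ds k\<close> and \<open>w k t\<close>
  is the noise it adds at iteration \<open>t\<close>. For \<open>t = 0\<close> the truncated difference \<open>t - 1\<close> is \<open>0\<close>, in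
  accordance with the convention $\lambda^{(-1)} = \lambda^{(0)} = 0$.\<close>

fun multiplier ::
    "real Matrix.vec \<Rightarrow> nat \<Rightarrow> (nat \<Rightarrow> real) \<Rightarrow> real
      \<Rightarrow> (dataset \<Rightarrow> real Matrix.vec \<Rightarrow> real Matrix.vec \<times> real Matrix.vec)
      \<Rightarrow> (nat \<Rightarrow> dataset) \<Rightarrow> (nat \<Rightarrow> nat \<Rightarrow> real Matrix.vec) \<Rightarrow> nat \<Rightarrow> real Matrix.vec" where
  "multiplier c K \<nu> \<gamma> sel Ds w 0 = 0\<^sub>v (dim_vec c)"
| "multiplier c K \<nu> \<gamma> sel Ds w (Suc t) =
     (let l = multiplier c K \<nu> \<gamma> sel Ds w t;
          l' = multiplier c K \<nu> \<gamma> sel Ds w (t - 1);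
          total = Matrix.vec (dim_vec c)
                    (\<lambda>j. \<Sum>k<K. vec_index (noisy_allocation sel (Ds k) l (w k t)) j)
      in l - \<nu> t \<cdot>\<^sub>v (c - total) + \<gamma> \<cdot>\<^sub>v (l - l'))"

definition published ::
    "real Matrix.vec \<Rightarrow> nat \<Rightarrow> nat \<Rightarrow> (nat \<Rightarrow> real) \<Rightarrow> real
      \<Rightarrow> (dataset \<Rightarrow> real Matrix.vec \<Rightarrow> real Matrix.vec \<times> real Matrix.vec)
      \<Rightarrow> (nat \<Rightarrow> nat \<Rightarrow> real Matrix.vec) \<Rightarrow> (nat \<Rightarrow> dataset) \<Rightarrow> (nat \<times> nat \<Rightarrow> real Matrix.vec)" where
  "published c K T \<nu> \<gamma> sel w Ds =
     (\<lambda>(k, t)\<in>{..<K} \<times> {..<T}.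
        noisy_allocation sel (Ds k) (multiplier c K \<nu> \<gamma> sel Ds w t) (w k t))"

definition output_space :: "real Matrix.vec \<Rightarrow> nat \<Rightarrow> nat \<Rightarrow> (nat \<times> nat \<Rightarrow> real Matrix.vec) measure" where
  "output_space c K T = (\<Pi>\<^sub>M (k, t)\<in>{..<K} \<times> {..<T}. vec_borel (dim_vec c))"

text \<open>Being a random variable is part of the definition: \<open>measure\<close> is \<open>0\<close> on non-measurable sets.\<close>

definition locally_dp ::
    "'w measure \<Rightarrow> 'd set \<Rightarrow> 'o measure \<Rightarrow> ('w \<Rightarrow> 'd \<Rightarrow> 'o) \<Rightarrow> real \<Rightarrow> real \<Rightarrow> bool" where
  "locally_dp M \<D> N A \<epsilon> \<delta> \<longleftrightarrow>
     (\<forall>D \<in> \<D>. (\<lambda>\<omega>. A \<omega> D) \<in> M \<rightarrow>\<^sub>M N) \<and>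
     (\<forall>D \<in> \<D>. \<forall>D' \<in> \<D>. \<forall>S \<in> sets N.
        measure M {\<omega> \<in> space M. A \<omega> D \<in> S}
          \<le> exp \<epsilon> * measure M {\<omega> \<in> space M. A \<omega> D' \<in> S} + \<delta>)"

definition multiparty_locally_dp ::
    "'w measure \<Rightarrow> nat \<Rightarrow> 'd set \<Rightarrow> 'o measure \<Rightarrow> ('w \<Rightarrow> (nat \<Rightarrow> 'd) \<Rightarrow> 'o) \<Rightarrow> real \<Rightarrow> real \<Rightarrow> bool" where
  "multiparty_locally_dp M K \<D> N A \<epsilon> \<delta> \<longleftrightarrow>
     (\<forall>k<K. \<forall>Ds. (\<forall>i<K. i \<noteq> k \<longrightarrow> Ds i \<in> \<D>) \<longrightarrow>
        locally_dp M \<D> N (\<lambda>\<omega> D. A \<omega> (Ds(k := D))) \<epsilon> \<delta>)"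

text \<open>The second parameter is the variance, whereas \<^const>\<open>normal_density\<close> takes the standard
  deviation; variance \<open>0\<close> gives the point mass.\<close>

definition gaussian :: "real \<Rightarrow> real \<Rightarrow> real measure" where
  "gaussian a v = (if v = 0 then return borel a
                   else density lborel (\<lambda>x. ennreal (normal_density a (sqrt v) x)))"

definition rho :: "real \<Rightarrow> real \<Rightarrow> real" where
  "rho \<epsilon> \<delta> = (sqrt (ln (1 / \<delta>) + \<epsilon>) - sqrt (ln (1 / \<delta>)))\<^sup>2"

end

theory Submission
  imports Defs
begin

text \<open>
  Changing the dataset of party \<open>k\<close> from \<open>D\<close> to \<open>D'\<close> can be compensated by the noise. If, at each
  iteration, the difference between the two allocations at the current multiplier is added to the
  noise of party \<open>k\<close>, then the run with \<open>D'\<close> publishes exactly what the run with \<open>D\<close> publishes with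
  the original noise (\<open>published_eqI\<close>). The multipliers are functions of the published values, so the
  shift at iteration \<open>t\<close> is determined by the noise before \<open>t\<close>; and since allocations lie between
  \<open>0\<close> and \<open>c\<close>, it is at most \<open>c\<^sub>j\<close> in coordinate \<open>j\<close> (\<open>allocation_bounds\<close>). Privacy thus becomes a
  statement about Gaussian noise: a predictable bounded shift of independent Gaussians increases the
  probability of an event at most by the factor \<open>exp \<epsilon>\<close> and the summand \<open>\<delta>\<close>
  (\<open>predictable_shift_privacy\<close>).

  The proof of that statement controls the Renyi divergence between shifted and unshifted noise, as
  in zero-concentrated differential privacy, but in the dual form given by Hoelder's inequality: if
  \<open>q = (1 + a) / a\<close>, then the expectation of \<open>f\<close> under the shifted noise is at most \<open>exp (a * \<rho>)\<close> times
  the \<open>L\<^sup>q\<close> norm of \<open>f\<close> under the unshifted noise. For one Gaussian of variance \<open>v\<close> and a shift \<open>d\<close>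
  this holds as soon as \<open>d\<^sup>2 \<le> 2 * v * \<rho>\<close> (\<open>gaussian_shift_moment_bound\<close>). The dual form tensorises along
  the order of time, adding up the values of \<open>\<rho>\<close>, without densities or conditional expectations on the
  product space (\<open>predictable_shift_moment_bound\<close>). With the variance \<open>T m c\<^sub>j\<^sup>2 / (2 * \<rho>)\<close>, each of
  the \<open>T m\<close> coordinates of party \<open>k\<close> contributes at most \<open>\<rho> / (T m)\<close>, hence \<open>\<rho>\<close> in total. For
  indicator functions \<open>f\<close> and the best order \<open>a\<close>, Young's inequality converts the bound into the pair
  \<open>(\<epsilon>, \<delta>)\<close> that defines \<open>\<rho>\<close>.
\<close>

section \<open>Shifts of one Gaussian variable\<close>

lemma prob_space_gaussian: "prob_space (gaussian a v)" if "v \<ge> 0"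
  using that by (auto simp: gaussian_def intro!: prob_space_return prob_space_normal_density)

lemma sets_gaussian [measurable_cong, simp]: "sets (gaussian a v) = sets borel"
  by (simp add: gaussian_def)

lemma space_gaussian [simp]: "space (gaussian a v) = UNIV"
  by (simp add: gaussian_def)

text \<open>At variance \<open>0\<close> there is no density, so integrals become Lebesgue integrals only for \<open>v > 0\<close>.\<close>

lemma integrable_gaussian_iff:
  fixes f :: "real \<Rightarrow> real"
  assumes "v > 0" "f \<in> borel_measurable borel"
  shows "integrable (gaussian a v) f \<longleftrightarrow> integrable lborel (\<lambda>x. normal_density a (sqrt v) x * f x)"
  using assms by (simp add: gaussian_def integrable_real_density)

lemma integral_gaussian:
  fixes f :: "real \<Rightarrow> real"
  assumes "v > 0" "f \<in> borel_measurable borel"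
  shows "(\<integral>x. f x \<partial>gaussian a v) = (\<integral>x. normal_density a (sqrt v) x * f x \<partial>lborel)"
  using assms by (simp add: gaussian_def integral_real_density)

lemma integrable_unit_interval:
  fixes f :: "'b \<Rightarrow> real"
  assumes "prob_space N" "f \<in> borel_measurable N" "\<And>x. 0 \<le> f x" "\<And>x. f x \<le> 1"
  shows "integrable N f"
  using assms
  by (intro finite_measure.integrable_const_bound[where B=1])
     (auto intro: prob_space.finite_measure)

text \<open>A non-integrable \<open>f\<close> has integral \<open>0\<close> by convention, so the bounds hold for every \<open>f\<close>. The
  induction over coordinates below uses this at points outside the product space, where the
  integrand need not be measurable.\<close>

lemma integral_unit_interval:
  fixes f :: "'b \<Rightarrow> real"
  assumes "prob_space N" "\<And>x. 0 \<le> f x" "\<And>x. f x \<le> 1"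
  shows "0 \<le> (\<integral>x. f x \<partial>N)" "(\<integral>x. f x \<partial>N) \<le> 1"
proof -
  show "0 \<le> (\<integral>x. f x \<partial>N)" using assms by simp
  show "(\<integral>x. f x \<partial>N) \<le> 1"
  proof (cases "integrable N f")
    case True
    then have "(\<integral>x. f x \<partial>N) \<le> (\<integral>x. 1 \<partial>N)"
      using assms by (intro integral_mono)
         (auto simp: prob_space.finite_measure finite_measure.integrable_const)
    then show ?thesis using assms(1) by (simp add: prob_space.prob_space)
  qed (simp add: not_integrable_integral_eq)
qed

text \<open>Completing the square: the density at mean \<open>d\<close> is, up to a constant, a weighted geometric mean of
  the densities at means \<open>0\<close> and \<open>(1 + a) d\<close>, because \<open>d = (a / (1 + a)) 0 + (1 / (1 + a)) (1 + a) d\<close>.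
  The logarithm of the constant is \<open>a / (1 + a)\<close> times the Renyi divergence of order \<open>1 + a\<close> of the
  Gaussian with mean \<open>d\<close> from that with mean \<open>0\<close>.\<close>

lemma normal_density_geometric_mean:
  assumes "v > 0" "a > 0"
  shows "normal_density d (sqrt v) x =
    exp (a * d\<^sup>2 / (2 * v)) *
      (normal_density 0 (sqrt v) x powr (a / (1 + a)) *
       normal_density ((1 + a) * d) (sqrt v) x powr (1 / (1 + a)))"
proof -
  define Z where "Z = 1 / sqrt (2 * pi * v)"
  have Z: "Z > 0" using assms by (simp add: Z_def)
  have nd: "normal_density u (sqrt v) x = Z * exp (- (x - u)\<^sup>2 / (2 * v))" for u
    using assms by (simp add: normal_density_def Z_def)
  have pow: "normal_density u (sqrt v) x powr s = Z powr s * exp (- (x - u)\<^sup>2 / (2 * v) * s)" for u s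
    unfolding nd using Z by (subst powr_mult) (auto simp: exp_powr_real)
  have "Z powr (a / (1 + a)) * Z powr (1 / (1 + a)) = Z"
    using Z assms by (simp add: powr_add[symmetric] add_divide_distrib[symmetric] add.commute)
  moreover have "- (x - d)\<^sup>2 / (2 * v) = a * d\<^sup>2 / (2 * v) + (- (x - 0)\<^sup>2 / (2 * v) * (a / (1 + a))
      + - (x - (1 + a) * d)\<^sup>2 / (2 * v) * (1 / (1 + a)))"
    using assms by (simp add: divide_simps) (simp add: power2_eq_square algebra_simps)
  ultimately show ?thesis
    unfolding pow unfolding nd by (simp add: exp_add[symmetric] mult_ac)
qed

text \<open>This is Hoelder's inequality with exponents \<open>q = (1 + a) / a\<close> and \<open>1 + a\<close>, applied to \<open>f\<close> and
  to the likelihood ratio of the Gaussians with means \<open>d\<close> and \<open>0\<close>. As the geometric mean above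
  already splits the density at \<open>d\<close> into the two Hoelder factors, only Young's inequality, with
  \<open>f powr q\<close> normalised by its integral \<open>F\<close>, is integrated. The hypothesis is written
  \<open>d\<^sup>2 \<le> 2 * v * B\<close> rather than \<open>d\<^sup>2 / (2 * v) \<le> B\<close> in order that \<open>v = 0\<close> forces \<open>d = 0\<close>: resources of
  capacity \<open>0\<close> receive no noise.\<close>

lemma gaussian_shift_moment_bound:
  fixes f :: "real \<Rightarrow> real"
  assumes a: "a > 0" and v: "v \<ge> 0" and B: "B \<ge> 0" and d: "d\<^sup>2 \<le> 2 * v * B"
    and f [measurable]: "f \<in> borel_measurable borel" and f01: "\<And>x. 0 \<le> f x" "\<And>x. f x \<le> 1"
  shows "(\<integral>x. f (x + d) \<partial>gaussian 0 v)
    \<le> exp (a * B) * (\<integral>x. f x powr ((1 + a) / a) \<partial>gaussian 0 v) powr (a / (1 + a))"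
proof (cases "v = 0")
  case True
  with d have "d = 0" by simp
  have "f 0 = (f 0 powr ((1 + a) / a)) powr (a / (1 + a))"
    using a f01[of 0] by (simp add: powr_powr)
  moreover have "1 * f 0 \<le> exp (a * B) * f 0"
    using a B f01 by (intro mult_right_mono) auto
  ultimately show ?thesis
    using True \<open>d = 0\<close> by (simp add: gaussian_def integral_return)
next
  case False
  then have v: "v > 0" using v by simp
  define q where "q = (1 + a) / a"
  define \<theta> where "\<theta> = a / (1 + a)"
  define \<phi> where "\<phi> = (\<lambda>u. normal_density u (sqrt v))"
  define F where "F = (\<integral>x. f x powr q \<partial>gaussian 0 v)"
  have [measurable]: "\<phi> u \<in> borel_measurable borel" for u by (simp add: \<phi>_def)
  have \<phi>pos: "\<phi> u x > 0" for u x using v by (simp add: \<phi>_def normal_density_pos)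
  have int\<phi>: "integrable lborel (\<phi> u)" "(\<integral>x. \<phi> u x \<partial>lborel) = 1" for u
    using v by (simp_all add: \<phi>_def)
  have q: "q > 0" using a by (simp add: q_def)
  have fq: "0 \<le> f x powr q" "f x powr q \<le> 1" for x
    using f01[of x] q by (auto intro: powr_le1)
  have Feq: "F = (\<integral>x. \<phi> 0 x * f x powr q \<partial>lborel)"
    unfolding F_def \<phi>_def using v by (subst integral_gaussian) auto
  have Fint: "integrable lborel (\<lambda>x. \<phi> 0 x * f x powr q)"
    unfolding \<phi>_def using v fq
    by (subst integrable_gaussian_iff[symmetric])
       (auto intro!: integrable_unit_interval prob_space_gaussian)
  have F0: "F \<ge> 0" unfolding F_def by simp
  have dint: "integrable lborel (\<lambda>x. \<phi> d x * f x)"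
    by (rule Bochner_Integration.integrable_bound[OF int\<phi>(1)[of d]])
       (auto simp: abs_mult less_imp_le[OF \<phi>pos] f01 intro!: mult_left_le)
  have "(\<integral>x. f (x + d) \<partial>gaussian 0 v) = (\<integral>x. \<phi> 0 x * f (x + d) \<partial>lborel)"
    unfolding \<phi>_def using v by (subst integral_gaussian) auto
  also have "\<dots> = (\<integral>x. \<phi> d (d + 1 * x) * f (d + 1 * x) \<partial>lborel)"
    by (intro Bochner_Integration.integral_cong) (auto simp: \<phi>_def normal_density_def add.commute)
  also have "\<dots> = (\<integral>x. \<phi> d x * f x \<partial>lborel)"
    by (subst lborel_integral_real_affine[where c=1 and t=d and f="\<lambda>x. \<phi> d x * f x"]) auto
  also have "\<dots> \<le> exp (a * d\<^sup>2 / (2 * v)) * F powr \<theta>"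
  proof (cases "F = 0")
    case True
    \<comment> \<open>Normalising by \<open>F\<close> is impossible here, but \<open>f\<close> vanishes almost everywhere, as \<open>\<phi> 0\<close> is positive.\<close>
    have "AE x in lborel. \<phi> 0 x * f x powr q = 0"
      using True Fint fq less_imp_le[OF \<phi>pos]
      by (subst integral_nonneg_eq_0_iff_AE[symmetric]) (auto simp: Feq[symmetric])
    then have "AE x in lborel. \<phi> d x * f x = 0"
      by eventually_elim (use \<phi>pos[of 0] in \<open>auto simp: less_irrefl\<close>, metis less_irrefl)
    then have "(\<integral>x. \<phi> d x * f x \<partial>lborel) = 0" by (rule integral_eq_zero_AE)
    then show ?thesis by simp
  next
    case False
    with F0 have F: "F > 0" by simp
    let ?g = "\<lambda>x. exp (a * d\<^sup>2 / (2 * v)) * F powr \<theta> *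
        (\<theta> / F * (\<phi> 0 x * f x powr q) + (1 - \<theta>) * \<phi> ((1 + a) * d) x)"
    have \<theta>: "0 \<le> \<theta>" "1 - \<theta> = 1 / (1 + a)" using a by (auto simp: \<theta>_def divide_simps)
    have "\<phi> d x * f x \<le> ?g x" for x
    proof (cases "f x = 0")
      case True
      then show ?thesis using F \<theta> a less_imp_le[OF \<phi>pos] by simp
    next
      case False
      then have "f x powr q > 0" by simp
      have q\<theta>: "(f x powr q) powr \<theta> = f x"
        using a f01[of x] by (simp add: powr_powr q_def \<theta>_def)
      have "(\<phi> 0 x * f x powr q / F) powr \<theta> * \<phi> ((1 + a) * d) x powr (1 - \<theta>)
          \<le> \<theta> * (\<phi> 0 x * f x powr q / F) + (1 - \<theta>) * \<phi> ((1 + a) * d) x"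
        using F \<phi>pos \<open>f x powr q > 0\<close> \<theta>(1) \<theta>(2) a by (intro Youngs_inequality_0) auto
      also have "(\<phi> 0 x * f x powr q / F) powr \<theta> = \<phi> 0 x powr \<theta> * f x / F powr \<theta>"
        using F less_imp_le[OF \<phi>pos] fq by (simp add: powr_divide powr_mult q\<theta>)
      finally have *: "\<phi> 0 x powr \<theta> * \<phi> ((1 + a) * d) x powr (1 - \<theta>) * f x / F powr \<theta>
          \<le> \<theta> / F * (\<phi> 0 x * f x powr q) + (1 - \<theta>) * \<phi> ((1 + a) * d) x"
        by (simp add: mult_ac)
      have "\<phi> d x * f x = exp (a * d\<^sup>2 / (2 * v)) * F powr \<theta> *
         (\<phi> 0 x powr \<theta> * \<phi> ((1 + a) * d) x powr (1 - \<theta>) * f x / F powr \<theta>)"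
        using F by (subst (1) \<phi>_def, subst normal_density_geometric_mean[OF v a])
           (simp add: \<theta>(2), simp add: \<phi>_def \<theta>_def)
      also have "\<dots> \<le> ?g x"
        using * by (intro mult_left_mono) auto
      finally show ?thesis .
    qed
    moreover have gint: "integrable lborel ?g"
      using Fint int\<phi> by (intro integrable_mult_right Bochner_Integration.integrable_add) auto
    ultimately have "(\<integral>x. \<phi> d x * f x \<partial>lborel) \<le> (\<integral>x. ?g x \<partial>lborel)"
      using dint by (intro integral_mono) auto
    also have "\<dots> = exp (a * d\<^sup>2 / (2 * v)) * F powr \<theta> * (\<theta> / F * F + (1 - \<theta>) * 1)"
      unfolding Feq using int\<phi> Fint by simp
    also have "\<dots> = exp (a * d\<^sup>2 / (2 * v)) * F powr \<theta>" using F by simp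
    finally show ?thesis .
  qed
  also have "\<dots> \<le> exp (a * B) * F powr \<theta>"
    using d v a by (intro mult_right_mono) (auto simp: divide_simps mult_ac)
  finally show ?thesis by (simp add: F_def \<theta>_def q_def)
qed

section \<open>Predictable shifts of independent Gaussian variables\<close>

text \<open>The Hoelder bound composes over coordinates even when each shift depends on the noise drawn
  before it. Remove a coordinate \<open>i\<close> of maximal rank: no other shift depends on it, and once the
  other coordinates are fixed, its own shift is a constant. The one-dimensional bound, applied in
  coordinate \<open>i\<close>, replaces \<open>f\<close> by its partial \<open>L\<^sup>q\<close> norm \<open>g\<close>, a function of the remaining coordinates,
  to which the induction hypothesis applies; the \<open>L\<^sup>q\<close> norm of \<open>g\<close> is that of \<open>f\<close> by Fubini. Keeping
  arbitrary \<open>f\<close> with values in the unit interval, instead of indicators, makes this step possible.\<close>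

lemma predictable_shift_moment_bound:
  fixes v B :: "'i \<Rightarrow> real" and r :: "'i \<Rightarrow> 'r :: linorder" and h :: "'i \<Rightarrow> ('i \<Rightarrow> real) \<Rightarrow> real"
    and f :: "('i \<Rightarrow> real) \<Rightarrow> real"
  assumes "finite I" and a: "a > 0" and v: "\<And>i. v i \<ge> 0" and B: "\<And>i. B i \<ge> 0"
    and "\<And>i. i \<in> I \<Longrightarrow> h i \<in> borel_measurable (\<Pi>\<^sub>M i\<in>I. borel)"
    and "\<And>i x y. i \<in> I \<Longrightarrow> (\<And>j. j \<in> I \<Longrightarrow> r j < r i \<Longrightarrow> x j = y j) \<Longrightarrow> h i x = h i y"
    and "\<And>i x. i \<in> I \<Longrightarrow> (h i x)\<^sup>2 \<le> 2 * v i * B i"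
    and "f \<in> borel_measurable (\<Pi>\<^sub>M i\<in>I. borel)" "\<And>x. 0 \<le> f x" "\<And>x. f x \<le> 1"
  shows "(\<integral>x. f (\<lambda>i\<in>I. x i + h i x) \<partial>(\<Pi>\<^sub>M i\<in>I. gaussian 0 (v i)))
    \<le> exp (a * (\<Sum>i\<in>I. B i)) *
        (\<integral>x. f x powr ((1 + a) / a) \<partial>(\<Pi>\<^sub>M i\<in>I. gaussian 0 (v i))) powr (a / (1 + a))"
  using assms(1,5-)
proof (induction I arbitrary: f rule: finite_ranking_induct[where f=r])
  case empty
  have "f x = (f x powr ((1 + a) / a)) powr (a / (1 + a))" for x
    using a empty.prems(5)[of x] by (simp add: powr_powr)
  then show ?case
    by (simp add: PiM_empty lebesgue_integral_count_space_finite restrict_def)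
next
  case (insert i I)
  show ?case
  proof (cases "i \<in> I")
    case True
    then have "insert i I = I" by auto
    show ?thesis
      unfolding \<open>insert i I = I\<close> by (rule insert.IH[OF insert.prems[unfolded \<open>insert i I = I\<close>]])
  next
    case False
    define q where "q = (1 + a) / a"
    define \<theta> where "\<theta> = a / (1 + a)"
    define N where "N = (\<lambda>i. gaussian 0 (v i))"
    have probN: "prob_space (N j)" for j unfolding N_def by (rule prob_space_gaussian[OF v])
    interpret N: product_sigma_finite N
      by (rule product_sigma_finite.intro) (rule prob_space_imp_sigma_finite[OF probN])
    have setsN [measurable_cong]: "sets (N j) = sets borel" for j by (simp add: N_def)
    have setsP [measurable_cong]: "sets (Pi\<^sub>M J N) = sets (Pi\<^sub>M J (\<lambda>_. borel))" for J
      by (intro sets_PiM_cong) (auto simp: N_def)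
    have q: "q > 0" and \<theta>q: "\<theta> * q = 1" and \<theta>: "\<theta> > 0"
      using a by (auto simp: q_def \<theta>_def)
    have f01: "0 \<le> f x" "f x \<le> 1" for x by (rule insert.prems(5), rule insert.prems(6))
    have fq01: "0 \<le> f x powr q" "f x powr q \<le> 1" for x
      using f01[of x] q by (auto intro: powr_le1)
    note [measurable] = insert.prems(4)
    have probP: "prob_space (Pi\<^sub>M J N)" for J by (rule prob_space_PiM) (rule probN)

    \<comment> \<open>Fixing coordinate \<open>i\<close> to \<open>0\<close> does not change any shift, so the shifts live on the smaller product.\<close>
    have hi [measurable]: "h i \<in> borel_measurable (Pi\<^sub>M I (\<lambda>_. borel))"
      and hI: "\<And>j. j \<in> I \<Longrightarrow> h j \<in> borel_measurable (Pi\<^sub>M I (\<lambda>_. borel))"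
    proof -
      have ext: "(\<lambda>x. x(i := 0)) \<in> Pi\<^sub>M I (\<lambda>_. borel) \<rightarrow>\<^sub>M Pi\<^sub>M (insert i I) (\<lambda>_. borel :: real measure)"
        by measurable
      have *: "h j \<in> borel_measurable (Pi\<^sub>M I (\<lambda>_. borel))" if "j \<in> insert i I" for j
      proof -
        have "h j = (\<lambda>x. h j (x(i := 0)))"
        proof (rule HOL.ext)
          fix x show "h j x = h j (x(i := 0))"
            using that insert.hyps(2)[of j] by (intro insert.prems(2)[of j]) auto
        qed
        moreover have "(\<lambda>x. h j (x(i := 0))) \<in> borel_measurable (Pi\<^sub>M I (\<lambda>_. borel))"
          using measurable_compose[OF ext insert.prems(1)[OF that]] .
        ultimately show ?thesis by simp
      qed
      then show "h i \<in> borel_measurable (Pi\<^sub>M I (\<lambda>_. borel))"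
        "\<And>j. j \<in> I \<Longrightarrow> h j \<in> borel_measurable (Pi\<^sub>M I (\<lambda>_. borel))" by auto
    qed
    have pred: "h j x = h j y" if "j \<in> I" "\<And>l. l \<in> I \<Longrightarrow> r l < r j \<Longrightarrow> x l = y l" for j x y
      using that insert.hyps(2)[of j] by (intro insert.prems(2)[of j]) auto
    have bound: "(h j x)\<^sup>2 \<le> 2 * v j * B j" if "j \<in> I" for j x
      using that by (intro insert.prems(3)) simp
    have h_upd: "h j (x(i := y)) = h j x" if "j \<in> insert i I" for j x y
      using that insert.hyps(2)[of j] by (intro insert.prems(2)[OF that]) auto
    have shift_meas [measurable]: "(\<lambda>x. \<lambda>j\<in>I. x j + h j x) \<in> Pi\<^sub>M I (\<lambda>_. borel) \<rightarrow>\<^sub>M Pi\<^sub>M I (\<lambda>_. borel)"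
      by (intro measurable_restrict borel_measurable_add hI) auto
    have shift_meas': "(\<lambda>x. \<lambda>j\<in>insert i I. x j + h j x)
        \<in> Pi\<^sub>M (insert i I) (\<lambda>_. borel) \<rightarrow>\<^sub>M Pi\<^sub>M (insert i I) (\<lambda>_. borel)"
      by (intro measurable_restrict borel_measurable_add insert.prems(1)) auto
    have fshift_meas: "(\<lambda>x. f (\<lambda>j\<in>insert i I. x j + h j x)) \<in> borel_measurable (Pi\<^sub>M (insert i I) (\<lambda>_. borel))"
      by (rule measurable_compose[OF shift_meas' insert.prems(4)])

    \<comment> \<open>The \<open>L\<^sup>q\<close> norm of \<open>f\<close> in coordinate \<open>i\<close> alone.\<close>
    define g where "g = (\<lambda>x. (\<integral>y. f (x(i := y)) powr q \<partial>N i) powr \<theta>)"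
    have upd [measurable]: "(\<lambda>(x, y). x(i := y)) \<in> Pi\<^sub>M I (\<lambda>_. borel) \<Otimes>\<^sub>M N i \<rightarrow>\<^sub>M Pi\<^sub>M (insert i I) (\<lambda>_. borel :: real measure)"
      by measurable
    have slice: "(\<lambda>y. f (x(i := y))) \<in> borel_measurable borel" if "x \<in> space (Pi\<^sub>M I N)" for x
    proof -
      have "(\<lambda>y. x(i := y)) \<in> borel \<rightarrow>\<^sub>M Pi\<^sub>M (insert i I) (\<lambda>_. borel :: real measure)"
        using that by (intro measurable_fun_upd[where J=I]) (auto simp: N_def space_PiM)
      then show ?thesis by (rule measurable_compose) (rule insert.prems(4))
    qed
    have g01: "0 \<le> g x" "g x \<le> 1" for x
      using integral_unit_interval[OF probN[of i], of "\<lambda>y. f (x(i := y)) powr q"] fq01 \<theta>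
      by (auto simp: g_def setsN intro!: powr_le1)
    have g_meas [measurable]: "g \<in> borel_measurable (Pi\<^sub>M I (\<lambda>_. borel))"
      unfolding g_def by measurable
    have "(\<integral>x. f (\<lambda>j\<in>insert i I. x j + h j x) \<partial>Pi\<^sub>M (insert i I) N)
        = (\<integral>x. (\<integral>y. f (\<lambda>j\<in>insert i I. (x(i := y)) j + h j (x(i := y))) \<partial>N i) \<partial>Pi\<^sub>M I N)"
      using insert.hyps(1) False f01 fshift_meas
      by (intro N.product_integral_insert integrable_unit_interval probP)
         (simp_all add: measurable_cong_sets[OF setsP refl] del: restrict_apply)
    also have "\<dots> = (\<integral>x. (\<integral>y. f ((\<lambda>j\<in>I. x j + h j x)(i := y + h i x)) \<partial>N i) \<partial>Pi\<^sub>M I N)"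
      using False by (intro Bochner_Integration.integral_cong refl arg_cong[where f=f]) (auto simp: h_upd)
    also have "\<dots> \<le> (\<integral>x. exp (a * B i) * g (\<lambda>j\<in>I. x j + h j x) \<partial>Pi\<^sub>M I N)"
    proof (rule integral_mono)
      show "integrable (Pi\<^sub>M I N) (\<lambda>x. exp (a * B i) * g (\<lambda>j\<in>I. x j + h j x))"
        using g01 by (intro integrable_mult_right integrable_unit_interval probP) measurable
      show "integrable (Pi\<^sub>M I N) (\<lambda>x. \<integral>y. f ((\<lambda>j\<in>I. x j + h j x)(i := y + h i x)) \<partial>N i)"
        using integral_unit_interval[OF probN[of i]] f01
        by (intro integrable_unit_interval probP) measurable
      fix x assume "x \<in> space (Pi\<^sub>M I N)"
      show "(\<integral>y. f ((\<lambda>j\<in>I. x j + h j x)(i := y + h i x)) \<partial>N i)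
          \<le> exp (a * B i) * g (\<lambda>j\<in>I. x j + h j x)"
        unfolding g_def N_def q_def \<theta>_def
        using gaussian_shift_moment_bound[OF a v B insert.prems(3)[of i x], of "\<lambda>y. f ((\<lambda>j\<in>I. x j + h j x)(i := y))"]
          slice[of "\<lambda>j\<in>I. x j + h j x"] f01 by (simp add: N_def space_PiM)
    qed
    also have "\<dots> \<le> exp (a * B i) * (exp (a * (\<Sum>i\<in>I. B i)) * (\<integral>x. g x powr q \<partial>Pi\<^sub>M I N) powr \<theta>)"
      unfolding N_def q_def \<theta>_def integral_mult_right_zero
      by (intro mult_left_mono insert.IH[OF hI pred bound g_meas g01]) auto
    also have "(\<integral>x. g x powr q \<partial>Pi\<^sub>M I N) = (\<integral>x. (\<integral>y. f (x(i := y)) powr q \<partial>N i) \<partial>Pi\<^sub>M I N)"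
      unfolding g_def by (intro Bochner_Integration.integral_cong refl) (simp add: powr_powr \<theta>q)
    also have "\<dots> = (\<integral>x. f x powr q \<partial>Pi\<^sub>M (insert i I) N)"
      using insert.hyps False fq01
      by (intro N.product_integral_insert[symmetric] integrable_unit_interval probP) auto
    finally show ?thesis
      using insert.hyps False
      by (simp add: N_def q_def \<theta>_def distrib_left exp_add mult.assoc)
  qed
qed

text \<open>For an indicator the moment bound reads \<open>Q A \<le> exp (a * \<rho>) * P A powr (a / (1 + a))\<close>, where
  \<open>Q\<close> is the law of the shifted noise. Young's inequality, with weights \<open>a / (1 + a)\<close> and
  \<open>1 / (1 + a)\<close>, turns the right-hand side into a sum of multiples of \<open>exp \<epsilon> * P A\<close> and
  \<open>exp (a * (\<rho> * (1 + a) - \<epsilon>))\<close>. The order \<open>a = sqrt (ln (1 / \<delta>) / \<rho>)\<close> minimises the latter, and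
  \<open>rho\<close> is exactly the \<open>\<rho>\<close> for which the minimum equals \<open>\<delta>\<close>, that is,
  \<open>\<epsilon> = \<rho> + 2 * sqrt (\<rho> * ln (1 / \<delta>))\<close>.\<close>

lemma predictable_shift_privacy:
  fixes I :: "'i set" and v B :: "'i \<Rightarrow> real" and r :: "'i \<Rightarrow> 'r :: linorder" and h :: "'i \<Rightarrow> ('i \<Rightarrow> real) \<Rightarrow> real"
  defines "P \<equiv> \<Pi>\<^sub>M i\<in>I. gaussian 0 (v i)"
  assumes "finite I" and v: "\<And>i. v i \<ge> 0" and B: "\<And>i. B i \<ge> 0"
    and h: "\<And>i. i \<in> I \<Longrightarrow> h i \<in> borel_measurable (\<Pi>\<^sub>M i\<in>I. borel)"
    and predictable: "\<And>i x y. i \<in> I \<Longrightarrow> (\<And>j. j \<in> I \<Longrightarrow> r j < r i \<Longrightarrow> x j = y j) \<Longrightarrow> h i x = h i y"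
    and bound: "\<And>i x. i \<in> I \<Longrightarrow> (h i x)\<^sup>2 \<le> 2 * v i * B i"
    and A: "A \<in> sets (\<Pi>\<^sub>M i\<in>I. borel)"
    and \<epsilon>: "\<epsilon> > 0" and \<delta>: "0 < \<delta>" "\<delta> \<le> 1" and budget: "(\<Sum>i\<in>I. B i) \<le> rho \<epsilon> \<delta>"
  shows "measure (P) {x \<in> space (P). (\<lambda>i\<in>I. x i + h i x) \<in> A} \<le> exp \<epsilon> * measure (P) A + \<delta>"
proof -
  have probP: "prob_space (P)"
    unfolding P_def by (rule prob_space_PiM) (rule prob_space_gaussian[OF v])
  have setsP: "sets (P) = sets (\<Pi>\<^sub>M i\<in>I. borel)"
    unfolding P_def by (intro sets_PiM_cong) auto
  define p where "p = measure (P) A"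
  have p: "p \<ge> 0" by (simp add: p_def)
  show ?thesis
  proof (cases "\<delta> = 1")
    case True
    \<comment> \<open>Here the optimal order would be \<open>a = 0\<close>, which the moment bound excludes, but \<open>\<delta> = 1\<close> bounds any probability.\<close>
    have "measure (P) {x \<in> space (P). (\<lambda>i\<in>I. x i + h i x) \<in> A} \<le> 1"
      by (rule prob_space.prob_le_1[OF probP])
    also have "\<dots> \<le> exp \<epsilon> * measure (P) A + \<delta>"
      using True by simp
    finally show ?thesis .
  next
    case False
    define l where "l = sqrt (ln (1 / \<delta>))"
    define s where "s = sqrt (ln (1 / \<delta>) + \<epsilon>) - l"
    define a where "a = l / s"
    have L: "ln (1 / \<delta>) > 0" using \<delta> False by simp
    have l: "l > 0" "l\<^sup>2 = ln (1 / \<delta>)" using L by (simp_all add: l_def)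
    have s: "s > 0" using \<epsilon> by (simp add: s_def l_def)
    have rho: "rho \<epsilon> \<delta> = s\<^sup>2" by (simp add: rho_def s_def l_def)
    have "(s + l)\<^sup>2 = l\<^sup>2 + \<epsilon>" using L \<epsilon> l(2) by (simp add: s_def)
    then have \<epsilon>_eq: "\<epsilon> = s\<^sup>2 + 2 * s * l" by (simp add: power2_eq_square algebra_simps)
    have a: "a > 0" using l s by (simp add: a_def)
    define f :: "('i \<Rightarrow> real) \<Rightarrow> real" where "f = indicator A"
    have f: "f \<in> borel_measurable (\<Pi>\<^sub>M i\<in>I. borel)" "0 \<le> f x" "f x \<le> 1" for x
      using A by (auto simp: f_def indicator_def)
    have "measure (P) {x \<in> space (P). (\<lambda>i\<in>I. x i + h i x) \<in> A}
        = (\<integral>x. indicator {x \<in> space (P). (\<lambda>i\<in>I. x i + h i x) \<in> A} x \<partial>P)"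
      by (simp add: Int_def conj_commute)
    also have "\<dots> = (\<integral>x. f (\<lambda>i\<in>I. x i + h i x) \<partial>P)"
      by (intro Bochner_Integration.integral_cong) (auto simp: f_def indicator_def)
    also have "\<dots> \<le> exp (a * (\<Sum>i\<in>I. B i)) * (\<integral>x. f x powr ((1 + a) / a) \<partial>P) powr (a / (1 + a))"
      unfolding P_def
      by (rule predictable_shift_moment_bound[OF \<open>finite I\<close> a v B h predictable bound f])
    also have "\<dots> \<le> exp (a * s\<^sup>2) * (\<integral>x. f x powr ((1 + a) / a) \<partial>P) powr (a / (1 + a))"
      using budget a by (intro mult_right_mono) (auto simp: rho)
    also have "(\<integral>x. f x powr ((1 + a) / a) \<partial>P) = p"
    proof -
      have "f x powr ((1 + a) / a) = indicator A x" for x by (simp add: f_def indicator_def)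
      then show ?thesis using sets.sets_into_space[of A "P"] A
        by (simp add: p_def setsP Int_absorb2)
    qed
    also have "exp (a * s\<^sup>2) * p powr (a / (1 + a)) \<le> exp \<epsilon> * p + \<delta>"
    proof (cases "p = 0")
      case False
      define \<theta> where "\<theta> = l / (l + s)"
      have \<theta>: "a / (1 + a) = \<theta>" "0 \<le> \<theta>" "\<theta> \<le> 1" "1 - \<theta> = s / (l + s)"
        using l s by (auto simp: \<theta>_def a_def divide_simps)
      \<comment> \<open>The choice of \<open>a\<close> makes the moment bound equal to the weighted geometric mean of \<open>exp \<epsilon> * p\<close> and \<open>\<delta>\<close>.\<close>
      have "a * s\<^sup>2 = \<epsilon> * \<theta> + (- (l\<^sup>2)) * (1 - \<theta>)"
        unfolding \<theta>(4) \<epsilon>_eq using l s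
        by (simp add: \<theta>_def a_def divide_simps) (simp add: power2_eq_square algebra_simps)
      moreover have "\<delta> powr (1 - \<theta>) = exp (- (l\<^sup>2) * (1 - \<theta>))"
        using \<delta> by (simp add: powr_def l(2) ln_div mult.commute)
      moreover have "(exp \<epsilon> * p) powr \<theta> = exp (\<epsilon> * \<theta>) * p powr \<theta>"
        using p by (subst powr_mult) (auto simp: exp_powr_real)
      ultimately have "exp (a * s\<^sup>2) * p powr \<theta> = (exp \<epsilon> * p) powr \<theta> * \<delta> powr (1 - \<theta>)"
        by (simp only: exp_add mult_ac)
      also have "\<dots> \<le> \<theta> * (exp \<epsilon> * p) + (1 - \<theta>) * \<delta>"
        using \<theta> \<delta> p False by (intro Youngs_inequality_0) auto
      also have "\<dots> \<le> 1 * (exp \<epsilon> * p) + 1 * \<delta>"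
        using \<theta> \<delta> p by (intro add_mono mult_right_mono) auto
      finally show ?thesis by (simp add: \<theta>)
    qed (use \<delta> in simp)
    finally show ?thesis unfolding p_def .
  qed
qed

section \<open>Measurability of vectors\<close>

lemma space_vec_borel: "space (vec_borel n) = carrier_vec n"
  by (simp add: vec_borel_def)

lemma measurable_vec_borelI:
  assumes "\<And>x. x \<in> space N \<Longrightarrow> f x \<in> carrier_vec n"
    and "\<And>j. j < n \<Longrightarrow> (\<lambda>x. vec_index (f x) j) \<in> borel_measurable N"
  shows "f \<in> N \<rightarrow>\<^sub>M vec_borel n"
  unfolding vec_borel_def using assms
  by (intro measurable_vimage_algebra2 measurable_restrict) auto

lemma measurable_vec_index:
  assumes "f \<in> N \<rightarrow>\<^sub>M vec_borel n" and "j < n"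
  shows "(\<lambda>x. vec_index (f x) j) \<in> borel_measurable N"
proof -
  have "(\<lambda>v. \<lambda>i\<in>{..<n}. vec_index v i) \<in> vec_borel n \<rightarrow>\<^sub>M (\<Pi>\<^sub>M i\<in>{..<n}. borel)"
    unfolding vec_borel_def by (rule measurable_vimage_algebra1) (auto simp: space_PiM)
  from measurable_compose[OF this measurable_component_singleton[of j "{..<n}"]]
  have "(\<lambda>v. vec_index v j) \<in> borel_measurable (vec_borel n)"
    using assms(2) by simp
  with assms(1) show ?thesis by (rule measurable_compose)
qed

section \<open>Allocations and multipliers\<close>

context
  fixes c :: "real Matrix.vec" and sel
  assumes sel: "argmax_selection c sel"
begin

text \<open>The constraint \<open>0 \<le> s \<le> c\<close> of the sub-problem is what bounds the sensitivity: two allocations of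
  resource \<open>j\<close> differ by at most \<open>c\<^sub>j\<close>, whatever the datasets are.\<close>

lemma allocation_bounds:
  assumes "D \<in> datasets c" and "l \<in> carrier_vec (dim_vec c)" and "j < dim_vec c"
  shows "0 \<le> vec_index (snd (sel D l)) j" "vec_index (snd (sel D l)) j \<le> vec_index c j"
proof -
  have "feasible c D (sel D l)"
    using sel assms(1,2) unfolding argmax_selection_def optimal_def is_arg_max_def by blast
  then have "0\<^sub>v (dim_vec c) \<le> snd (sel D l)" and le: "snd (sel D l) \<le> c"
    unfolding feasible_def case_prod_unfold by blast+
  then have dim: "dim_vec (snd (sel D l)) = dim_vec c"
    and ge: "\<forall>j<dim_vec (snd (sel D l)). vec_index (0\<^sub>v (dim_vec c)) j \<le> vec_index (snd (sel D l)) j"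
    unfolding less_eq_vec_def by blast+
  show "0 \<le> vec_index (snd (sel D l)) j"
    using ge[rule_format, of j] assms(3) by (simp add: dim)
  show "vec_index (snd (sel D l)) j \<le> vec_index c j"
    using le assms(3) unfolding less_eq_vec_def by blast
qed

lemma measurable_allocation:
  assumes "D \<in> datasets c" and "f \<in> N \<rightarrow>\<^sub>M vec_borel (dim_vec c)"
  shows "(\<lambda>x. snd (sel D (f x))) \<in> N \<rightarrow>\<^sub>M vec_borel (dim_vec c)"
proof -
  have "sel D \<in> vec_borel (dim_vec c) \<rightarrow>\<^sub>M vec_borel (dim_vec (dsu D)) \<Otimes>\<^sub>M vec_borel (dim_vec c)"
    using sel assms(1) unfolding argmax_selection_def by blast
  then show ?thesis
    using measurable_compose[OF assms(2)] measurable_compose[OF _ measurable_snd] by blast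
qed

end

lemma multiplier_carrier: "multiplier c K \<nu> \<gamma> sel Ds w t \<in> carrier_vec (dim_vec c)"
proof (induction t rule: less_induct)
  case (less t)
  show ?case
  proof (cases t)
    case (Suc s)
    then show ?thesis using less[of s] less[of "s - 1"] by (auto simp: Let_def)
  qed simp
qed

text \<open>The multipliers see the private data only through the noisy allocations. The hypothesis compares
  the allocations at the multipliers of the first run only, so that it can be checked without knowing
  anything about the second run.\<close>

lemma multiplier_eqI:
  assumes "\<And>i s. i < K \<Longrightarrow> s < t \<Longrightarrow>
      noisy_allocation sel (Ds i) (multiplier c K \<nu> \<gamma> sel Ds w s) (w i s)
      = noisy_allocation sel (Ds' i) (multiplier c K \<nu> \<gamma> sel Ds w s) (w' i s)"
  shows "multiplier c K \<nu> \<gamma> sel Ds w t = multiplier c K \<nu> \<gamma> sel Ds' w' t"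
  using assms
proof (induction t rule: less_induct)
  case (less t)
  show ?case
  proof (cases t)
    case (Suc s)
    have "multiplier c K \<nu> \<gamma> sel Ds w s = multiplier c K \<nu> \<gamma> sel Ds' w' s"
      "multiplier c K \<nu> \<gamma> sel Ds w (s - 1) = multiplier c K \<nu> \<gamma> sel Ds' w' (s - 1)"
      using Suc by (auto intro!: less.IH less.prems)
    moreover have "noisy_allocation sel (Ds i) (multiplier c K \<nu> \<gamma> sel Ds w s) (w i s)
      = noisy_allocation sel (Ds' i) (multiplier c K \<nu> \<gamma> sel Ds w s) (w' i s)" if "i < K" for i
      using Suc that by (intro less.prems) auto
    ultimately show ?thesis using Suc by (simp add: Let_def)
  qed simp
qed

lemma published_eqI:
  assumes "\<And>i s. i < K \<Longrightarrow> s < T \<Longrightarrow>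
      noisy_allocation sel (Ds i) (multiplier c K \<nu> \<gamma> sel Ds w s) (w i s)
      = noisy_allocation sel (Ds' i) (multiplier c K \<nu> \<gamma> sel Ds w s) (w' i s)"
  shows "published c K T \<nu> \<gamma> sel w Ds = published c K T \<nu> \<gamma> sel w' Ds'"
proof -
  have "multiplier c K \<nu> \<gamma> sel Ds w t = multiplier c K \<nu> \<gamma> sel Ds' w' t" if "t < T" for t
    using that by (intro multiplier_eqI assms) auto
  with assms show ?thesis by (auto simp: published_def fun_eq_iff restrict_def)
qed

lemma published_cong_noise:
  assumes "\<And>i s. i < K \<Longrightarrow> s < T \<Longrightarrow> w i s = w' i s"
  shows "published c K T \<nu> \<gamma> sel w Ds = published c K T \<nu> \<gamma> sel w' Ds"
  by (rule published_eqI) (simp add: assms)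

lemma measurable_noisy_allocation:
  assumes "argmax_selection c sel" "D \<in> datasets c" "l \<in> N \<rightarrow>\<^sub>M vec_borel (dim_vec c)"
    and "w \<in> N \<rightarrow>\<^sub>M vec_borel (dim_vec c)"
  shows "(\<lambda>x. noisy_allocation sel D (l x) (w x)) \<in> N \<rightarrow>\<^sub>M vec_borel (dim_vec c)"
proof (rule measurable_vec_borelI)
  note s = measurable_allocation[OF assms(1-3)]
  have w: "w x \<in> carrier_vec (dim_vec c)" if "x \<in> space N" for x
    using measurable_space[OF assms(4) that] by (simp add: space_vec_borel)
  then show "noisy_allocation sel D (l x) (w x) \<in> carrier_vec (dim_vec c)" if "x \<in> space N" for x
    using that by (intro carrier_vecI) (simp add: noisy_allocation_def carrier_vecD)
  fix j assume j: "j < dim_vec c"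
  have "(\<lambda>x. vec_index (snd (sel D (l x))) j + vec_index (w x) j) \<in> borel_measurable N"
    by (intro borel_measurable_add measurable_vec_index[OF s j] measurable_vec_index[OF assms(4) j])
  also have "?this \<longleftrightarrow> (\<lambda>x. vec_index (noisy_allocation sel D (l x) (w x)) j) \<in> borel_measurable N"
    using w[THEN carrier_vecD] j by (intro measurable_cong) (auto simp: noisy_allocation_def)
  finally show \<dots> .
qed

lemma measurable_multiplier:
  assumes sel: "argmax_selection c sel" and D: "\<And>i. i < K \<Longrightarrow> Ds i \<in> datasets c"
    and w: "\<And>i s. i < K \<Longrightarrow> s < t \<Longrightarrow> (\<lambda>x. w x i s) \<in> N \<rightarrow>\<^sub>M vec_borel (dim_vec c)"
  shows "(\<lambda>x. multiplier c K \<nu> \<gamma> sel Ds (w x) t) \<in> N \<rightarrow>\<^sub>M vec_borel (dim_vec c)"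
  using w
proof (induction t rule: less_induct)
  case (less t)
  show ?case
  proof (cases t)
    case 0
    then show ?thesis by (auto intro: measurable_const simp: space_vec_borel)
  next
    case (Suc s)
    let ?l = "\<lambda>x. multiplier c K \<nu> \<gamma> sel Ds (w x)"
    have l: "(\<lambda>x. ?l x s) \<in> N \<rightarrow>\<^sub>M vec_borel (dim_vec c)" "(\<lambda>x. ?l x (s - 1)) \<in> N \<rightarrow>\<^sub>M vec_borel (dim_vec c)"
      using Suc by (auto intro!: less.IH less.prems)
    have noisy: "(\<lambda>x. noisy_allocation sel (Ds i) (?l x s) (w x i s)) \<in> N \<rightarrow>\<^sub>M vec_borel (dim_vec c)"
      if "i < K" for i
      using Suc that by (intro measurable_noisy_allocation sel D l less.prems) auto
    show ?thesis
    proof (rule measurable_vec_borelI)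
      fix j assume j: "j < dim_vec c"
      have "(\<lambda>x. vec_index (?l x s) j
            - \<nu> s * (vec_index c j - (\<Sum>k<K. vec_index (noisy_allocation sel (Ds k) (?l x s) (w x k s)) j))
            + \<gamma> * (vec_index (?l x s) j - vec_index (?l x (s - 1)) j)) \<in> borel_measurable N"
        by (intro borel_measurable_add borel_measurable_diff borel_measurable_times borel_measurable_const
            borel_measurable_sum measurable_vec_index[OF l(1) j] measurable_vec_index[OF l(2) j]
            measurable_vec_index[OF noisy j]) auto
      also have "(\<lambda>x. vec_index (?l x s) j
            - \<nu> s * (vec_index c j - (\<Sum>k<K. vec_index (noisy_allocation sel (Ds k) (?l x s) (w x k s)) j))
            + \<gamma> * (vec_index (?l x s) j - vec_index (?l x (s - 1)) j))
          = (\<lambda>x. vec_index (?l x t) j)"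
      proof
        fix x
        have "dim_vec (?l x s) = dim_vec c" "dim_vec (?l x (s - 1)) = dim_vec c"
          by (rule carrier_vecD[OF multiplier_carrier])+
        with j Suc show "vec_index (?l x s) j
            - \<nu> s * (vec_index c j - (\<Sum>k<K. vec_index (noisy_allocation sel (Ds k) (?l x s) (w x k s)) j))
            + \<gamma> * (vec_index (?l x s) j - vec_index (?l x (s - 1)) j) = vec_index (?l x t) j"
          by (simp add: Let_def)
      qed
      finally show "(\<lambda>x. vec_index (?l x t) j) \<in> borel_measurable N" .
    qed (rule multiplier_carrier)
  qed
qed

lemma measurable_published:
  assumes sel: "argmax_selection c sel" and D: "\<And>i. i < K \<Longrightarrow> Ds i \<in> datasets c"
    and w: "\<And>i s. i < K \<Longrightarrow> s < T \<Longrightarrow> (\<lambda>x. w x i s) \<in> N \<rightarrow>\<^sub>M vec_borel (dim_vec c)"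
  shows "(\<lambda>x. published c K T \<nu> \<gamma> sel (w x) Ds) \<in> N \<rightarrow>\<^sub>M output_space c K T"
  unfolding published_def output_space_def
proof (rule measurable_restrict)
  fix kt assume "kt \<in> {..<K} \<times> {..<T}"
  then obtain k t where kt: "kt = (k, t)" "k < K" "t < T" by auto
  have "(\<lambda>x. noisy_allocation sel (Ds k) (multiplier c K \<nu> \<gamma> sel Ds (w x) t) (w x k t))
      \<in> N \<rightarrow>\<^sub>M vec_borel (dim_vec c)"
    using kt by (intro measurable_noisy_allocation measurable_multiplier sel D w) auto
  then show "(\<lambda>x. case kt of (k, t) \<Rightarrow> noisy_allocation sel (Ds k)
      (multiplier c K \<nu> \<gamma> sel Ds (w x) t) (w x k t)) \<in> N \<rightarrow>\<^sub>M (case kt of (k, t) \<Rightarrow> vec_borel (dim_vec c))"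
    using kt by simp
qed

text \<open>The noise of all parties, resources and iterations is kept as one point \<open>x\<close> of a finite product of
  real lines, with the index order \<open>(k, j, t)\<close>; this is the form needed for the shift lemmas.\<close>

definition noise_vectors :: "nat \<Rightarrow> (nat \<times> nat \<times> nat \<Rightarrow> real) \<Rightarrow> nat \<Rightarrow> nat \<Rightarrow> real Matrix.vec" where
  "noise_vectors m x = (\<lambda>k t. Matrix.vec m (\<lambda>j. x (k, j, t)))"

lemma measurable_noise_vectors:
  assumes "i < K" "s < T"
  shows "(\<lambda>x. noise_vectors m x i s) \<in> (\<Pi>\<^sub>M i\<in>{..<K} \<times> {..<m} \<times> {..<T}. borel) \<rightarrow>\<^sub>M vec_borel m"
  unfolding noise_vectors_def
  using assms by (intro measurable_vec_borelI) (auto intro!: measurable_component_singleton)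

section \<open>Local differential privacy of the allocation algorithm\<close>

theorem proposition2p1:
  fixes \<epsilon> \<delta> \<gamma> :: real and T K m :: nat and c :: "real Matrix.vec"
    and \<nu> :: "nat \<Rightarrow> real"
    and sel :: "dataset \<Rightarrow> real Matrix.vec \<Rightarrow> real Matrix.vec \<times> real Matrix.vec"
    and M :: "'w measure"
    and \<omega> :: "nat \<Rightarrow> nat \<Rightarrow> nat \<Rightarrow> 'w \<Rightarrow> real"
  assumes "\<epsilon> > 0" and "0 < \<delta>" and "\<delta> \<le> 1" and "T \<ge> 1" and "K > 1" and "m \<ge> 1"
    and "c \<in> carrier_vec m" and "\<forall>j<m. vec_index c j \<ge> 0"
    and "\<forall>t. \<nu> t > 0" and "\<gamma> \<ge> 0"
    and "argmax_selection c sel"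
    and "prob_space M"
    and "prob_space.indep_vars M (\<lambda>_. borel) (\<lambda>(k, j, t). \<omega> k j t) ({..<K} \<times> {..<m} \<times> {..<T})"
    and "\<forall>k<K. \<forall>j<m. \<forall>t<T.
           distr M borel (\<omega> k j t)
             = gaussian 0 (real T * real m * (vec_index c j)\<^sup>2 / (2 * rho \<epsilon> \<delta>))"
  shows "multiparty_locally_dp M K (datasets c) (output_space c K T)
           (\<lambda>w. published c K T \<nu> \<gamma> sel (\<lambda>k t. Matrix.vec m (\<lambda>j. \<omega> k j t w))) \<epsilon> \<delta>"
proof -
  interpret prob_space M by fact
  note sel = \<open>argmax_selection c sel\<close>
  have dim: "dim_vec c = m" using assms by auto
  define I where "I = {..<K} \<times> {..<m} \<times> {..<T}"
  define \<rho> where "\<rho> = rho \<epsilon> \<delta>"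
  define v where "v = (\<lambda>(k :: nat, j, t :: nat). real T * real m * (vec_index c j)\<^sup>2 / (2 * \<rho>))"
  define X where "X = (\<lambda>(k, j, t). \<omega> k j t)"
  define W where "W = (\<lambda>w. \<lambda>i\<in>I. X i w)"
  define P where "P = (\<Pi>\<^sub>M i\<in>I. gaussian 0 (v i))"
  define out where "out = (\<lambda>Ds x. published c K T \<nu> \<gamma> sel (noise_vectors m x) Ds)"
  have finI: "finite I" and I0: "I \<noteq> {}"
    using assms(4-6) by (auto simp: I_def lessThan_empty_iff)
  have "sqrt (ln (1 / \<delta>)) < sqrt (ln (1 / \<delta>) + \<epsilon>)" using assms by simp
  then have \<rho>: "\<rho> > 0" by (simp add: \<rho>_def rho_def)
  have v: "v i \<ge> 0" for i using \<rho> by (auto simp: v_def split: prod.splits)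
  have setsP [measurable_cong]: "sets P = sets (\<Pi>\<^sub>M i\<in>I. borel)"
    unfolding P_def by (intro sets_PiM_cong) auto
  have rv: "X i \<in> borel_measurable M" if "i \<in> I" for i
    using assms(13) that unfolding indep_vars_def X_def[symmetric] I_def[symmetric] by auto
  have W: "W \<in> M \<rightarrow>\<^sub>M (\<Pi>\<^sub>M i\<in>I. borel)"
    unfolding W_def by (intro measurable_restrict rv)
  \<comment> \<open>Independence of the noise variables: jointly they are distributed as the product of Gaussians.\<close>
  have law: "distr M (\<Pi>\<^sub>M i\<in>I. borel) W = P"
  proof -
    have "distr M (\<Pi>\<^sub>M i\<in>I. borel) W = (\<Pi>\<^sub>M i\<in>I. distr M borel (X i))"
      unfolding W_def using assms(13) rv I0
      by (subst indep_vars_iff_distr_eq_PiM'[symmetric]) (auto simp: X_def I_def)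
    also have "\<dots> = P"
      unfolding P_def using assms(14) by (intro PiM_cong) (auto simp: I_def X_def v_def \<rho>_def)
    finally show ?thesis .
  qed
  have pub_W: "published c K T \<nu> \<gamma> sel (\<lambda>k t. Matrix.vec m (\<lambda>j. \<omega> k j t w)) Ds = out Ds (W w)" for w Ds
    unfolding out_def by (rule published_cong_noise) (auto simp: noise_vectors_def W_def I_def X_def intro!: eq_vecI)
  have out: "out Ds \<in> (\<Pi>\<^sub>M i\<in>I. borel) \<rightarrow>\<^sub>M output_space c K T" if "\<And>i. i < K \<Longrightarrow> Ds i \<in> datasets c" for Ds
    unfolding out_def
    by (rule measurable_published[OF sel that]) (auto simp: dim I_def intro!: measurable_noise_vectors)
  have out_sets: "{x \<in> space P. out Ds x \<in> S} \<in> sets (\<Pi>\<^sub>M i\<in>I. borel)"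
    if "\<And>i. i < K \<Longrightarrow> Ds i \<in> datasets c" "S \<in> sets (output_space c K T)" for Ds S
  proof -
    have "{x \<in> space P. out Ds x \<in> S} = out Ds -` S \<inter> space (\<Pi>\<^sub>M i\<in>I. borel)"
      by (auto simp: sets_eq_imp_space_eq[OF setsP])
    then show ?thesis using measurable_sets[OF out[OF that(1)] that(2)] by simp
  qed
  have prob_out: "measure M {w \<in> space M. out Ds (W w) \<in> S} = measure P {x \<in> space P. out Ds x \<in> S}"
    if "\<And>i. i < K \<Longrightarrow> Ds i \<in> datasets c" "S \<in> sets (output_space c K T)" for Ds S
  proof -
    have "W w \<in> space P" if "w \<in> space M" for w
      using measurable_space[OF W that] by (simp add: sets_eq_imp_space_eq[OF setsP])
    then have "{w \<in> space M. out Ds (W w) \<in> S} = W -` {x \<in> space P. out Ds x \<in> S} \<inter> space M"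
      by auto
    then have "measure M {w \<in> space M. out Ds (W w) \<in> S}
        = measure (distr M (\<Pi>\<^sub>M i\<in>I. borel) W) {x \<in> space P. out Ds x \<in> S}"
      by (simp add: measure_distr[OF W out_sets[OF that]])
    then show ?thesis unfolding law .
  qed
  have privacy: "measure P {x \<in> space P. out (Ds(k := D)) x \<in> S}
      \<le> exp \<epsilon> * measure P {x \<in> space P. out (Ds(k := D')) x \<in> S} + \<delta>"
    if k: "k < K" and Ds: "\<And>i. i < K \<Longrightarrow> i \<noteq> k \<Longrightarrow> Ds i \<in> datasets c"
      and D: "D \<in> datasets c" "D' \<in> datasets c" and S: "S \<in> sets (output_space c K T)" for k Ds D D' S
  proof -
    define l where "l = (\<lambda>x. multiplier c K \<nu> \<gamma> sel (Ds(k := D)) (noise_vectors m x))"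
    \<comment> \<open>Party \<open>k\<close>, holding \<open>D'\<close> instead of \<open>D\<close>, publishes the same values if its noise is moved by \<open>h\<close>.\<close>
    define h where "h = (\<lambda>(i, j, t) x. if i = k
        then vec_index (snd (sel D (l x t))) j - vec_index (snd (sel D' (l x t))) j else 0)"
    \<comment> \<open>The privacy budget \<open>\<rho>\<close> is spread evenly over the \<open>T m\<close> noise variables of party \<open>k\<close>.\<close>
    define B where "B = (\<lambda>(i, j :: nat, t :: nat). if i = k then \<rho> / (real T * real m) else 0)"
    define A where "A = {x \<in> space P. out (Ds(k := D')) x \<in> S}"
    have E: "(Ds(k := D)) i \<in> datasets c" "(Ds(k := D')) i \<in> datasets c" if "i < K" for i
      using that Ds D by auto
    have l_carrier: "l x t \<in> carrier_vec (dim_vec c)" for x t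
      unfolding l_def by (rule multiplier_carrier)
    have l_meas: "(\<lambda>x. l x t) \<in> (\<Pi>\<^sub>M i\<in>I. borel) \<rightarrow>\<^sub>M vec_borel (dim_vec c)" if "t < T" for t
      unfolding l_def using that
      by (intro measurable_multiplier[OF sel E(1)]) (auto simp: dim I_def intro!: measurable_noise_vectors)
    have h_meas: "h i \<in> borel_measurable (\<Pi>\<^sub>M i\<in>I. borel)" if iI: "i \<in> I" for i
    proof -
      obtain i' j t where i: "i = (i', j, t)" "j < dim_vec c" "t < T"
        using iI dim by (auto simp: I_def)
      have "(\<lambda>x. vec_index (snd (sel D (l x t))) j - vec_index (snd (sel D' (l x t))) j)
          \<in> borel_measurable (\<Pi>\<^sub>M i\<in>I. borel)"
        by (intro borel_measurable_diff measurable_vec_index[OF measurable_allocation[OF sel _ l_meas[OF i(3)]] i(2)] D)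
      then show ?thesis by (simp add: h_def i)
    qed
    have h_bound: "(h i x)\<^sup>2 \<le> 2 * v i * B i" if iI: "i \<in> I" for i x
    proof -
      obtain i' j t where i: "i = (i', j, t)" "j < dim_vec c" "t < T"
        using iI dim by (auto simp: I_def)
      have "\<bar>h i x\<bar> \<le> \<bar>vec_index c j\<bar>" if "i' = k"
        using allocation_bounds[OF sel D(1) l_carrier i(2), of x t]
          allocation_bounds[OF sel D(2) l_carrier i(2), of x t] that
        by (simp add: h_def i(1))
      then have "(h i x)\<^sup>2 \<le> (vec_index c j)\<^sup>2" if "i' = k"
        using that abs_le_square_iff by blast
      moreover have "2 * v i * B i = (vec_index c j)\<^sup>2" if "i' = k"
        using that \<rho> assms(4,6) by (simp add: v_def B_def i(1))
      ultimately show ?thesis by (cases "i' = k") (auto simp: h_def B_def i(1))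
    qed
    \<comment> \<open>The shift at iteration \<open>t\<close> is a function of \<open>l x t\<close>, which is computed from earlier noise only.\<close>
    have h_pred: "h i x = h i y"
      if iI: "i \<in> I" and agree: "\<And>j. j \<in> I \<Longrightarrow> snd (snd j) < snd (snd i) \<Longrightarrow> x j = y j" for i x y
    proof -
      obtain i' j t where i: "i = (i', j, t)" "t < T"
        using iI by (auto simp: I_def)
      have "l x t = l y t" unfolding l_def
      proof (rule multiplier_eqI)
        fix i'' s assume "i'' < K" "s < t"
        then have "noise_vectors m x i'' s = noise_vectors m y i'' s"
          using i by (auto simp: noise_vectors_def I_def intro!: eq_vecI agree)
        then show "noisy_allocation sel ((Ds(k := D)) i'') (multiplier c K \<nu> \<gamma> sel (Ds(k := D)) (noise_vectors m x) s) (noise_vectors m x i'' s) =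
           noisy_allocation sel ((Ds(k := D)) i'') (multiplier c K \<nu> \<gamma> sel (Ds(k := D)) (noise_vectors m x) s) (noise_vectors m y i'' s)"
          by simp
      qed
      then show ?thesis by (simp add: h_def i(1))
    qed
    have "(\<Sum>i\<in>I. B i) = (\<Sum>i<K. if i = k then \<rho> else 0)"
      using assms(4,6) unfolding I_def B_def sum.cartesian_product'
      by (intro sum.cong) auto
    then have budget: "(\<Sum>i\<in>I. B i) \<le> rho \<epsilon> \<delta>" using k by (simp add: \<rho>_def)
    have same_out: "out (Ds(k := D)) x = out (Ds(k := D')) (\<lambda>i\<in>I. x i + h i x)" for x
      unfolding out_def
    proof (rule published_eqI)
      fix i s assume "i < K" "s < T"
      then have "noisy_allocation sel ((Ds(k := D)) i) (l x s) (noise_vectors m x i s) =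
          noisy_allocation sel ((Ds(k := D')) i) (l x s) (noise_vectors m (\<lambda>i\<in>I. x i + h i x) i s)"
        by (auto simp: noisy_allocation_def noise_vectors_def I_def h_def intro!: eq_vecI)
      then show "noisy_allocation sel ((Ds(k := D)) i)
            (multiplier c K \<nu> \<gamma> sel (Ds(k := D)) (noise_vectors m x) s) (noise_vectors m x i s)
          = noisy_allocation sel ((Ds(k := D')) i)
            (multiplier c K \<nu> \<gamma> sel (Ds(k := D)) (noise_vectors m x) s)
            (noise_vectors m (\<lambda>i\<in>I. x i + h i x) i s)"
        unfolding l_def .
    qed
    have B_nonneg: "B i \<ge> 0" for i using \<rho> by (simp add: B_def split: prod.splits)
    have A: "A \<in> sets (\<Pi>\<^sub>M i\<in>I. borel)"
      unfolding A_def by (rule out_sets[OF E(2) S])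
    have "{x \<in> space P. out (Ds(k := D)) x \<in> S} = {x \<in> space P. (\<lambda>i\<in>I. x i + h i x) \<in> A}"
      by (auto simp: A_def same_out[symmetric] P_def space_PiM)
    moreover have "measure P {x \<in> space P. (\<lambda>i\<in>I. x i + h i x) \<in> A} \<le> exp \<epsilon> * measure P A + \<delta>"
      unfolding P_def
      by (rule predictable_shift_privacy[where r="\<lambda>i. snd (snd i)" and h=h and B=B,
            OF finI v B_nonneg h_meas h_pred h_bound A assms(1-3) budget])
    ultimately show ?thesis by (simp add: A_def)
  qed
  show ?thesis
    unfolding multiparty_locally_dp_def locally_dp_def pub_W
  proof (intro allI impI conjI ballI)
    fix k Ds D assume *: "k < K" "\<forall>i<K. i \<noteq> k \<longrightarrow> Ds i \<in> datasets c" "D \<in> datasets c"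
    then have "(Ds(k := D)) i \<in> datasets c" if "i < K" for i using that by auto
    then show "(\<lambda>w. out (Ds(k := D)) (W w)) \<in> M \<rightarrow>\<^sub>M output_space c K T"
      by (intro measurable_compose[OF W out])
  next
    fix k Ds D D' S
    assume *: "k < K" "\<forall>i<K. i \<noteq> k \<longrightarrow> Ds i \<in> datasets c" "D \<in> datasets c" "D' \<in> datasets c"
      "S \<in> sets (output_space c K T)"
    then have E: "(Ds(k := D)) i \<in> datasets c" "(Ds(k := D')) i \<in> datasets c" if "i < K" for i
      using that by auto
    have eqs: "measure M {w \<in> space M. out (Ds(k := D)) (W w) \<in> S}
          = measure P {x \<in> space P. out (Ds(k := D)) x \<in> S}"
      "measure M {w \<in> space M. out (Ds(k := D')) (W w) \<in> S}
          = measure P {x \<in> space P. out (Ds(k := D')) x \<in> S}"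
      by (rule prob_out; use E * in blast)+
    show "measure M {w \<in> space M. out (Ds(k := D)) (W w) \<in> S}
        \<le> exp \<epsilon> * measure M {w \<in> space M. out (Ds(k := D')) (W w) \<in> S} + \<delta>"
      unfolding eqs by (rule privacy) (use * in auto)
  qed
qed

end
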